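(* Let $\mathbb F$ be a field of characteristic $2$, let $(L,[\cdot,\cdot],(\cdot)^{[2]})$ be a restricted Lie algebra over $\mathbb F$ and let $(m_t,\omega_t)$, $m_t=\sum_{i\ge0}t^im_i$, $\omega_t=\sum_{i\ge0}t^i\omega_i$, be a restricted formal deformation of $L$. Then $(m_1,\omega_1)$ is a $2$-cocycle of the restricted cohomology of $L$ with adjoint coefficients, that is, $(m_1,\omega_1)\in C^2_{*_2}(L,L)$, $d^2_{CE}m_1=0$ and $\delta^2\omega_1=0$.
   Context: A restricted Lie algebra in characteristic $2$ is a Lie algebra $L$ with a map $(\cdot)^{[2]}:L\to L$ such that $(\lambda x)^{[2]}=\lambda^2x^{[2]}$, $[x,y^{[2]}]=[[x,y],y]$, $(x+y)^{[2]}=x^{[2]}+y^{[2]}+[x,y]$. Restricted formal deformation of $L$: maps $m_t=\sum_{i\ge0}t^im_i:L\times L\to L[[t]]$ and $\omega_t=\sum_{i\ge0}t^i\omega_i:L\to L[[t]]$ with $m_0=[\cdot,\cdot]$, $\omega_0=(\cdot)^{[2]}$, each $m_i:L\times L\to L$ bilinear antisymmetric, each $\omega_i:L\to L$ with $\omega_i(\lambda x)=\lambda^2\omega_i(x)$, such that, $m_t$ being extended to $L[[t]]$ by $m_t(\sum_it^ix_i,\sum_jt^jy_j)=\sum_{i,j}t^{i+j}m_t(x_i,y_j)$, for all $x,y,z\in L$: $m_t(x,m_t(y,z))+m_t(y,m_t(z,x))+m_t(z,m_t(x,y))=0$; $m_t(x,\omega_t(y))=m_t(m_t(x,y),y)$;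 $\omega_t(x+y)=\omega_t(x)+\omega_t(y)+m_t(x,y)$. $C^2_{*_2}(L,L)$ is the space of pairs $(\varphi,\omega)$ with $\varphi:L\times L\to L$ alternating bilinear, $\omega:L\to L$, $\omega(\lambda x)=\lambda^2\omega(x)$, $\omega(x+y)=\omega(x)+\omega(y)+\varphi(x,y)$. For $(\varphi,\omega)\in C^2_{*_2}(L,L)$: $d^2_{CE}\varphi(x,y,z)=\varphi([x,y],z)+\varphi([x,z],y)+\varphi([y,z],x)+[x,\varphi(y,z)]+[y,\varphi(x,z)]+[z,\varphi(x,y)]$ and $\delta^2\omega(x,z)=[x,\varphi(x,z)]+[z,\omega(x)]+\varphi(x^{[2]},z)+\varphi([x,z],x)$ (for $\delta^2\omega_1$ the associated $\varphi$ is $m_1$). *)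

theory Defs
  imports "HOL-Computational_Algebra.Formal_Power_Series"
begin

text \<open>
  A vector space \<open>L\<close> over a field is a type \<open>'v\<close> together with a scalar multiplication
  \<open>scale\<close> in the sense of the library locale \<open>vector_space\<close>. The space \<open>L[[t]]\<close> is the type
  \<open>'v fps\<close>, with \<open>L\<close> embedded by \<open>fps_const\<close>.
\<close>

definition bilinear_map :: "('f::field \<Rightarrow> 'v::ab_group_add \<Rightarrow> 'v) \<Rightarrow> ('v \<Rightarrow> 'v \<Rightarrow> 'v) \<Rightarrow> bool" where
  "bilinear_map scale \<phi> \<longleftrightarrow>
     (\<forall>x. Vector_Spaces.linear scale scale (\<lambda>y. \<phi> x y)) \<and>
     (\<forall>y. Vector_Spaces.linear scale scale (\<lambda>x. \<phi> x y))"

definition alternating_map :: "('v \<Rightarrow> 'v \<Rightarrow> 'v::zero) \<Rightarrow> bool" where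
  "alternating_map \<phi> \<longleftrightarrow> (\<forall>x. \<phi> x x = 0)"

text \<open>Strictly weaker than alternating in characteristic 2.\<close>

definition antisymmetric_map :: "('v \<Rightarrow> 'v \<Rightarrow> 'v::uminus) \<Rightarrow> bool" where
  "antisymmetric_map \<phi> \<longleftrightarrow> (\<forall>x y. \<phi> x y = - \<phi> y x)"

locale lie_algebra = vector_space scale
  for scale :: "'f::field \<Rightarrow> 'v::ab_group_add \<Rightarrow> 'v" +
  fixes bracket :: "'v \<Rightarrow> 'v \<Rightarrow> 'v"
  assumes bracket_bilinear: "bilinear_map scale bracket"
    and bracket_alternating: "alternating_map bracket"
    and jacobi: "bracket x (bracket y z) + bracket y (bracket z x) + bracket z (bracket x y) = 0"

text \<open>
  These are the axioms of a \<open>[p]\<close>-map for \<open>p = 2\<close>; they are meant over a field of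
  characteristic 2, which is not part of the locale.
\<close>

locale restricted_lie_algebra_2 = lie_algebra scale bracket
  for scale :: "'f::field \<Rightarrow> 'v::ab_group_add \<Rightarrow> 'v" and bracket :: "'v \<Rightarrow> 'v \<Rightarrow> 'v" +
  fixes sq :: "'v \<Rightarrow> 'v"
  assumes sq_scale: "sq (scale a x) = scale (a^2) (sq x)"
    and bracket_sq: "bracket x (sq y) = bracket (bracket x y) y"
    and sq_add: "sq (x + y) = sq x + sq y + bracket x y"

text \<open>
  The extension of \<open>M : L \<times> L \<rightarrow> L[[t]]\<close> to \<open>L[[t]]\<close>: the coefficient of \<open>t\<^sup>n\<close> in
  the sum of all \<open>t\<^sup>i\<^sup>+\<^sup>j M(x\<^sub>i, y\<^sub>j)\<close>.
\<close>

definition fps_extend :: "('v \<Rightarrow> 'v \<Rightarrow> 'v fps) \<Rightarrow> 'v fps \<Rightarrow> 'v fps \<Rightarrow> ('v::ab_group_add) fps" where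
  "fps_extend M X Y =
     Abs_fps (\<lambda>n. \<Sum>i\<le>n. \<Sum>j\<le>n - i. fps_nth (M (fps_nth X i) (fps_nth Y j)) (n - (i + j)))"

definition restricted_formal_deformation ::
  "('f::field \<Rightarrow> 'v::ab_group_add \<Rightarrow> 'v) \<Rightarrow> ('v \<Rightarrow> 'v \<Rightarrow> 'v) \<Rightarrow> ('v \<Rightarrow> 'v) \<Rightarrow>
   (nat \<Rightarrow> 'v \<Rightarrow> 'v \<Rightarrow> 'v) \<Rightarrow> (nat \<Rightarrow> 'v \<Rightarrow> 'v) \<Rightarrow> bool" where
  "restricted_formal_deformation scale bracket sq m \<omega> \<longleftrightarrow>
     m 0 = bracket \<and> \<omega> 0 = sq \<and>
     (\<forall>i. bilinear_map scale (m i) \<and> antisymmetric_map (m i)) \<and>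
     (\<forall>i a x. \<omega> i (scale a x) = scale (a^2) (\<omega> i x)) \<and>
     (let m\<^sub>t = (\<lambda>x y. Abs_fps (\<lambda>i. m i x y));
          \<omega>\<^sub>t = (\<lambda>x. Abs_fps (\<lambda>i. \<omega> i x));
          M = fps_extend m\<^sub>t;
          c = fps_const
      in (\<forall>x y z. M (c x) (m\<^sub>t y z) + M (c y) (m\<^sub>t z x) + M (c z) (m\<^sub>t x y) = 0) \<and>
         (\<forall>x y. M (c x) (\<omega>\<^sub>t y) = M (m\<^sub>t x y) (c y)) \<and>
         (\<forall>x y. \<omega>\<^sub>t (x + y) = \<omega>\<^sub>t x + \<omega>\<^sub>t y + m\<^sub>t x y))"

text \<open>Restricted 2-cochains and 2-cocycles with adjoint coefficients; signs are immaterial in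
  characteristic 2 and therefore omitted.\<close>

definition restricted_C2 ::
  "('f::field \<Rightarrow> 'v::ab_group_add \<Rightarrow> 'v) \<Rightarrow> (('v \<Rightarrow> 'v \<Rightarrow> 'v) \<times> ('v \<Rightarrow> 'v)) set" where
  "restricted_C2 scale = {(\<phi>, \<omega>). bilinear_map scale \<phi> \<and> alternating_map \<phi> \<and>
     (\<forall>a x. \<omega> (scale a x) = scale (a^2) (\<omega> x)) \<and>
     (\<forall>x y. \<omega> (x + y) = \<omega> x + \<omega> y + \<phi> x y)}"

definition d2_CE ::
  "('v \<Rightarrow> 'v \<Rightarrow> 'v::ab_group_add) \<Rightarrow> ('v \<Rightarrow> 'v \<Rightarrow> 'v) \<Rightarrow> 'v \<Rightarrow> 'v \<Rightarrow> 'v \<Rightarrow> 'v" where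
  "d2_CE bracket \<phi> x y z =
     \<phi> (bracket x y) z + \<phi> (bracket x z) y + \<phi> (bracket y z) x
     + bracket x (\<phi> y z) + bracket y (\<phi> x z) + bracket z (\<phi> x y)"

definition delta2 ::
  "('v \<Rightarrow> 'v \<Rightarrow> 'v::ab_group_add) \<Rightarrow> ('v \<Rightarrow> 'v) \<Rightarrow> ('v \<Rightarrow> 'v \<Rightarrow> 'v) \<times> ('v \<Rightarrow> 'v) \<Rightarrow> 'v \<Rightarrow> 'v \<Rightarrow> 'v" where
  "delta2 bracket sq = (\<lambda>(\<phi>, \<omega>) x z.
     bracket x (\<phi> x z) + bracket z (\<omega> x) + \<phi> (sq x) z + \<phi> (bracket x z) x)"

definition restricted_Z2 ::
  "('f::field \<Rightarrow> 'v::ab_group_add \<Rightarrow> 'v) \<Rightarrow> ('v \<Rightarrow> 'v \<Rightarrow> 'v) \<Rightarrow> ('v \<Rightarrow> 'v) \<Rightarrow>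
   (('v \<Rightarrow> 'v \<Rightarrow> 'v) \<times> ('v \<Rightarrow> 'v)) set" where
  "restricted_Z2 scale bracket sq = {(\<phi>, \<omega>). (\<phi>, \<omega>) \<in> restricted_C2 scale \<and>
     (\<forall>x y z. d2_CE bracket \<phi> x y z = 0) \<and>
     (\<forall>x z. delta2 bracket sq (\<phi>, \<omega>) x z = 0)}"

end

theory Submission
  imports Defs
begin

text \<open>
  The cocycle conditions are the coefficients of \<open>t\<close> in the deformation equations, up to the
  symmetry of the \<open>m\<^sub>i\<close> in characteristic 2. That \<open>m\<^sub>1\<close> is alternating, and not merely
  antisymmetric, comes from \<open>\<omega>\<^sub>1(x + x) = 2 \<omega>\<^sub>1(x) + m\<^sub>1(x, x)\<close>, where
  \<open>\<omega>\<^sub>1(x + x) = \<omega>\<^sub>1(0) = 0\<close>.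
\<close>

lemma (in vector_space) add_self_eq_0:
  fixes x :: 'b
  assumes "CHAR('a) = 2"
  shows "x + x = 0"
proof -
  have "(1 + 1 :: 'a) = of_nat CHAR('a)"
    using assms by simp
  then have "(1 + 1 :: 'a) = 0"
    by (simp only: of_nat_CHAR)
  then show ?thesis
    using scale_left_distrib[of 1 1 x] by simp
qed

text \<open>Serves to discard the terms in which a constant series contributes its
  \<open>t\<close>-coefficient, which is 0.\<close>

lemma bilinear_map_zero:
  assumes "bilinear_map scale \<phi>"
  shows "\<phi> x 0 = 0" "\<phi> 0 x = 0"
proof -
  have "Vector_Spaces.linear scale scale (\<phi> x)" "Vector_Spaces.linear scale scale (\<lambda>y. \<phi> y x)"
    using assms by (auto simp: bilinear_map_def)
  then interpret l: Vector_Spaces.linear scale scale "\<phi> x"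
      + r: Vector_Spaces.linear scale scale "\<lambda>y. \<phi> y x" .
  show "\<phi> x 0 = 0" "\<phi> 0 x = 0"
    by (rule l.zero, rule r.zero)
qed

text \<open>The power \<open>t\<close> arises in three ways: from \<open>M\<close> itself, from
  \<open>Y\<close>, or from \<open>X\<close>. If \<open>X\<close> or \<open>Y\<close> is constant,
  only two of them survive for a bilinear \<open>M\<close>.\<close>

lemma fps_extend_nth_1:
  "fps_nth (fps_extend M X Y) 1 =
     fps_nth (M (fps_nth X 0) (fps_nth Y 0)) 1 + fps_nth (M (fps_nth X 0) (fps_nth Y 1)) 0
     + fps_nth (M (fps_nth X 1) (fps_nth Y 0)) 0"
  by (simp add: fps_extend_def)

theorem proposition4p13:
  fixes scale :: "'f::field \<Rightarrow> 'v::ab_group_add \<Rightarrow> 'v"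
    and bracket :: "'v \<Rightarrow> 'v \<Rightarrow> 'v" and sq :: "'v \<Rightarrow> 'v"
    and m :: "nat \<Rightarrow> 'v \<Rightarrow> 'v \<Rightarrow> 'v" and \<omega> :: "nat \<Rightarrow> 'v \<Rightarrow> 'v"
  assumes "CHAR('f) = 2"
    and "restricted_lie_algebra_2 scale bracket sq"
    and "restricted_formal_deformation scale bracket sq m \<omega>"
  shows "(m 1, \<omega> 1) \<in> restricted_Z2 scale bracket sq"
proof -
  interpret restricted_lie_algebra_2 scale bracket sq by fact
  note add_self = add_self_eq_0[OF assms(1)]
  have neg: "- x = x" for x :: 'v
    using add_self[of x] by (simp add: minus_unique)

  define M where "M = fps_extend (\<lambda>x y. Abs_fps (\<lambda>i. m i x y))"
  have m0: "m 0 = bracket" and w0: "\<omega> 0 = sq"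
    and bil: "bilinear_map scale (m i)"
    and asym: "antisymmetric_map (m i)"
    and wscale: "\<omega> i (scale a x) = scale (a^2) (\<omega> i x)"
    and jac: "M (fps_const x) (Abs_fps (\<lambda>i. m i y z)) + M (fps_const y) (Abs_fps (\<lambda>i. m i z x))
      + M (fps_const z) (Abs_fps (\<lambda>i. m i x y)) = 0"
    and msq: "M (fps_const x) (Abs_fps (\<lambda>i. \<omega> i y)) = M (Abs_fps (\<lambda>i. m i x y)) (fps_const y)"
    and wadd: "Abs_fps (\<lambda>i. \<omega> i (x + y)) =
      Abs_fps (\<lambda>i. \<omega> i x) + Abs_fps (\<lambda>i. \<omega> i y) + Abs_fps (\<lambda>i. m i x y)"
    for i a x y z
    using assms(3) unfolding restricted_formal_deformation_def Let_def M_def by blast+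

  have sym: "m i x y = m i y x" for i x y
    using asym[of i] neg by (metis antisymmetric_map_def)
  have bsym: "bracket x y = bracket y x" for x y
    using sym[of 0] by (simp add: m0)
  note zero = bilinear_map_zero[OF bil] bilinear_map_zero[OF bracket_bilinear]

  have wadd1: "\<omega> 1 (x + y) = \<omega> 1 x + \<omega> 1 y + m 1 x y" for x y
    using arg_cong[OF wadd[of x y], of "\<lambda>f. fps_nth f 1"] by simp
  have "m 1 x x = 0" for x
  proof -
    \<comment> \<open>Homogeneity with the scalar 0.\<close>
    have "\<omega> 1 0 = 0"
      using wscale[of 1 0 0] by simp
    then show ?thesis
      using wadd1[of x x] by (simp add: add_self)
  qed
  then have C2: "(m 1, \<omega> 1) \<in> restricted_C2 scale"
    using bil wscale wadd1 by (simp add: restricted_C2_def alternating_map_def)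

  have "m 1 x (bracket y z) + bracket x (m 1 y z) + (m 1 y (bracket z x) + bracket y (m 1 z x))
      + (m 1 z (bracket x y) + bracket z (m 1 x y)) = 0" for x y z
    using arg_cong[OF jac[of x y z], of "\<lambda>f. fps_nth f 1"]
    by (simp add: M_def fps_extend_nth_1[unfolded One_nat_def] m0 zero)
  \<comment> \<open>The six summands agree with those above once the arguments of \<open>m 1\<close>
    and of \<open>bracket\<close> are swapped, which costs no sign in characteristic 2.\<close>
  then have d2: "d2_CE bracket (m 1) x y z = 0" for x y z
    by (simp add: d2_CE_def algebra_simps sym[of _ "bracket x y" z] sym[of _ "bracket z x" y]
        sym[of _ "bracket y z" x] sym[of _ x z] bsym[of x z])

  have "delta2 bracket sq (m 1, \<omega> 1) x z = 0" for x z
  proof -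
    \<comment> \<open>\<open>msq\<close> is taken at \<open>z\<close>, \<open>x\<close> because
      \<open>delta2\<close> squares its first argument \<open>x\<close>.\<close>
    have "m 1 z (sq x) + bracket z (\<omega> 1 x) = m 1 (bracket z x) x + bracket (m 1 z x) x"
      using arg_cong[OF msq[of z x], of "\<lambda>f. fps_nth f 1"]
      by (simp add: M_def fps_extend_nth_1[unfolded One_nat_def] m0 w0 zero)
    then have "m 1 (sq x) z + bracket z (\<omega> 1 x) = m 1 (bracket x z) x + bracket x (m 1 x z)"
      by (metis sym bsym)
    \<comment> \<open>\<open>delta2\<close> is the sum of the two sides of the preceding equation,
      hence twice its right side.\<close>
    then have "delta2 bracket sq (m 1, \<omega> 1) x z =
        (m 1 (bracket x z) x + bracket x (m 1 x z)) + (m 1 (bracket x z) x + bracket x (m 1 x z))"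
      by (simp add: delta2_def algebra_simps)
    then show ?thesis
      by (simp only: add_self)
  qed
  with C2 d2 show ?thesis
    by (simp add: restricted_Z2_def)
qed

end
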